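(* $$\lim_{R\to\infty}\frac{\# \left(\Gamma_4\mathbf{e}_1\cap [-R,R]^2\right)}{4R^2} = \frac{4\sqrt{2}}{\pi^2} \qquad\text{and}\qquad \lim_{R\to\infty}\frac{\# \left(\Gamma_6\mathbf{e}_1\cap [-R,R]^2\right)}{4R^2} = \frac{3\sqrt{3}}{\pi^2}.$$
   Context: For an integer $q\geq 3$ let $\lambda_q = 2\cos(\pi/q)$ (so $\lambda_4=\sqrt{2}$ and $\lambda_6=\sqrt{3}$). The Hecke triangle group $\Gamma_q$ is the subgroup of $\mathrm{SL}(2,\mathbb{R})$ generated by the two matrices $\begin{pmatrix}0 & 1 \\ -1 & 0\end{pmatrix}$ and $\begin{pmatrix}1 & \lambda_q \\ 0 & 1\end{pmatrix}$. Let $\mathbf{e}_1=\begin{pmatrix}1\\0\end{pmatrix}\in\mathbb{R}^2$, and let $\Gamma_q\mathbf{e}_1=\{g\mathbf{e}_1: g\in\Gamma_q\}\subset\mathbb{R}^2$ be its orbit under matrix-vector multiplication. $\#$ denotes cardinality. *)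

theory Defs
  imports "HOL-Analysis.Analysis" "HOL-Algebra.Generated_Groups"
begin

definition SL2R :: "(real^2^2) monoid" where
  "SL2R = \<lparr>carrier = {A. det A = 1}, mult = (**), one = mat 1\<rparr>"

lemma group_SL2R: "group SL2R"
proof (rule groupI)
  fix A :: "real^2^2"
  assume "A \<in> carrier SL2R"
  hence A: "det A = 1"
    by (simp add: SL2R_def)
  hence "invertible A"
    by (simp add: invertible_det_nz)
  then obtain B where B: "B ** A = mat 1"
    unfolding invertible_def by blast
  have "det B * det A = 1"
    using B by (metis det_I det_mul)
  with A have "det B = 1"
    by simp
  with B show "\<exists>B\<in>carrier SL2R. B \<otimes>\<^bsub>SL2R\<^esub> A = \<one>\<^bsub>SL2R\<^esub>"
    by (auto simp: SL2R_def)
qed (auto simp: SL2R_def det_mul matrix_mul_assoc)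

definition hecke_lambda :: "nat \<Rightarrow> real" where
  "hecke_lambda q = 2 * cos (pi / real q)"

text \<open>Matrices are given by their list of rows. The definitions are meant for \<open>q \<ge> 3\<close>.\<close>

definition hecke_S :: "real^2^2" where
  "hecke_S = vector [vector [0, 1], vector [-1, 0]]"

definition hecke_T :: "nat \<Rightarrow> real^2^2" where
  "hecke_T q = vector [vector [1, hecke_lambda q], vector [0, 1]]"

definition hecke_group :: "nat \<Rightarrow> (real^2^2) set" where
  "hecke_group q = generate SL2R {hecke_S, hecke_T q}"

lemma hecke_group_subgroup: "subgroup (hecke_group q) SL2R"
  unfolding hecke_group_def
  by (rule group.generate_is_subgroup[OF group_SL2R])
     (auto simp: SL2R_def hecke_S_def hecke_T_def det_2)

definition hecke_orbit :: "nat \<Rightarrow> (real^2) set" where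
  "hecke_orbit q = {g *v vector [1, 0] | g. g \<in> hecke_group q}"

definition square :: "real \<Rightarrow> (real^2) set" where
  "square R = {v. \<forall>i. v $ i \<in> {-R..R}}"

end

theory Submission
  imports Defs "HOL-Real_Asymp.Real_Asymp" "HOL-Computational_Algebra.Primes"
begin

text \<open>
  Both values of \<open>q\<close> have \<open>\<lambda>\<^sub>q = sqrt m\<close> with \<open>m\<close> prime, namely \<open>m = 2\<close> and \<open>m = 3\<close>, and in that case the
  orbit is an explicit arithmetic set: the vectors \<open>(x, y sqrt m)\<close> with integers \<open>x\<close>, \<open>y\<close> such that
  \<open>gcd(x, m y) = 1\<close>, together with their reflections in the diagonal (\<open>hecke_orbit_eq\<close>). The
  generators preserve this set; conversely, since \<open>\<lambda> < 2\<close>, a Euclidean algorithm made of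
  quarter turns and shears by \<open>\<plusminus>\<lambda>\<close> shortens each vector of the set until it is \<open>\<plusminus>e\<^sub>1\<close>. It stops because
  squared lengths of these vectors are natural numbers.

  It remains to count the pairs with \<open>gcd(x, m y) = 1\<close>, \<open>\<bar>x\<bar> \<le> R\<close>, \<open>\<bar>y\<bar> \<le> R / sqrt m\<close>. Let \<open>P(R)\<close> be their
  number. The pairs in the same rectangle that satisfy only \<open>\<not> m dvd x\<close> are easy to count: their number
  \<open>G(R)\<close> is asymptotic to \<open>c R\<^sup>2\<close> with \<open>c = 4 (1 - 1/m) / sqrt m\<close>. Sorting them by the gcd of the two
  coordinates shows that \<open>G(R)\<close> is the sum of \<open>P(R/d)\<close> over all \<open>d \<ge> 1\<close> not divisible by \<open>m\<close>.
  So with \<open>f(R) = P(R) / R\<^sup>2\<close> and the weights \<open>w\<^sub>d = 1 / d\<^sup>2\<close> for \<open>\<not> m dvd d\<close>, of total mass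
  \<open>W = (1 - 1/m\<^sup>2) \<pi>\<^sup>2 / 6\<close>, the averages \<open>\<Sum> w\<^sub>d f(R/d)\<close> tend to \<open>c\<close>.

  To recover the limit of \<open>f\<close> one would usually invert this relation with the Moebius function. The
  inequality \<open>W < 2\<close> offers a shortcut: \<open>h = f - c/W\<close> is bounded, and \<open>h(R)\<close> equals
  \<open>- \<Sum> w\<^sub>d h(R/d)\<close>, summed over \<open>d \<ge> 2\<close>, up to an error tending to 0, where the total weight on the right is \<open>W - 1 < 1\<close>. Hence
  any asymptotic bound on \<open>\<bar>h\<bar>\<close> improves itself by a constant factor less than 1, and
  \<open>h\<close> tends to 0 (\<open>tendsto_of_dilation_average\<close>). Therefore \<open>P(R) / R\<^sup>2\<close> tends to \<open>c / W\<close>, and the orbit,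
  consisting of two disjoint copies, has density \<open>2 (c / W) / 4 = 12 sqrt m / ((m + 1) \<pi>\<^sup>2)\<close>.
\<close>

section \<open>The orbit as an arithmetic set\<close>

lemma hecke_S_mult: "hecke_S *v vector [u, w] = (vector [w, - u] :: real^2)"
  by (simp add: hecke_S_def vec_eq_iff forall_2 matrix_vector_mult_def sum_2)

lemma hecke_T_mult: "hecke_T q *v vector [u, w] = (vector [u + hecke_lambda q * w, w] :: real^2)"
  by (simp add: hecke_T_def vec_eq_iff forall_2 matrix_vector_mult_def sum_2)

lemma inv_hecke_S: "inv\<^bsub>SL2R\<^esub> hecke_S = - hecke_S"
proof (rule group.inv_equality[OF group_SL2R])
  show "- hecke_S \<otimes>\<^bsub>SL2R\<^esub> hecke_S = \<one>\<^bsub>SL2R\<^esub>"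
    by (simp add: SL2R_def hecke_S_def vec_eq_iff forall_2 matrix_matrix_mult_def sum_2 mat_def)
qed (auto simp: SL2R_def hecke_S_def det_2)

lemma inv_hecke_T:
  "inv\<^bsub>SL2R\<^esub> (hecke_T q) = vector [vector [1, - hecke_lambda q], vector [0, 1]]"
proof (rule group.inv_equality[OF group_SL2R])
  show "vector [vector [1, - hecke_lambda q], vector [0, 1]] \<otimes>\<^bsub>SL2R\<^esub> hecke_T q = \<one>\<^bsub>SL2R\<^esub>"
    by (simp add: SL2R_def hecke_T_def vec_eq_iff forall_2 matrix_matrix_mult_def sum_2 mat_def)
qed (auto simp: SL2R_def hecke_T_def det_2)

lemma inv_hecke_S_mult: "inv\<^bsub>SL2R\<^esub> hecke_S *v vector [u, w] = (vector [- w, u] :: real^2)"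
  by (simp only: inv_hecke_S) (simp add: hecke_S_def vec_eq_iff forall_2 matrix_vector_mult_def sum_2)

lemma inv_hecke_T_mult:
  "inv\<^bsub>SL2R\<^esub> (hecke_T q) *v vector [u, w] = (vector [u - hecke_lambda q * w, w] :: real^2)"
  by (simp add: inv_hecke_T vec_eq_iff forall_2 matrix_vector_mult_def sum_2)

lemma hecke_orbit_closed:
  assumes "g \<in> hecke_group q" "v \<in> hecke_orbit q"
  shows "g *v v \<in> hecke_orbit q"
proof -
  obtain h where h: "h \<in> hecke_group q" "v = h *v vector [1, 0]"
    using assms(2) by (auto simp: hecke_orbit_def)
  have "g ** h \<in> hecke_group q"
    using generate.eng[of g SL2R _ h] assms(1) h(1) by (simp add: hecke_group_def SL2R_def)
  then show ?thesis
    using h(2) by (auto simp: hecke_orbit_def matrix_vector_mul_assoc)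
qed

lemma hecke_orbit_moves:
  assumes "vector [u, w] \<in> hecke_orbit q"
  shows "vector [w, - u] \<in> hecke_orbit q" "vector [- w, u] \<in> hecke_orbit q"
    and "vector [u + hecke_lambda q * w, w] \<in> hecke_orbit q"
    and "vector [u - hecke_lambda q * w, w] \<in> hecke_orbit q"
proof -
  have gens: "hecke_S \<in> hecke_group q" "inv\<^bsub>SL2R\<^esub> hecke_S \<in> hecke_group q"
    "hecke_T q \<in> hecke_group q" "inv\<^bsub>SL2R\<^esub> (hecke_T q) \<in> hecke_group q"
    unfolding hecke_group_def by (auto intro: generate.incl generate.inv)
  show "vector [w, - u] \<in> hecke_orbit q" "vector [- w, u] \<in> hecke_orbit q"
    "vector [u + hecke_lambda q * w, w] \<in> hecke_orbit q"
    "vector [u - hecke_lambda q * w, w] \<in> hecke_orbit q"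
    using gens[THEN hecke_orbit_closed, OF assms]
    by (simp_all add: hecke_S_mult hecke_T_mult inv_hecke_S_mult inv_hecke_T_mult)
qed

lemma one_zero_in_hecke_orbit: "vector [1, 0] \<in> hecke_orbit q"
proof -
  have "mat 1 \<in> hecke_group q"
    using generate.one[of SL2R] by (simp add: hecke_group_def SL2R_def)
  then show ?thesis
    unfolding hecke_orbit_def by (auto intro!: exI[of _ "mat 1"])
qed

text \<open>
  When \<open>\<lambda>\<^sub>q = sqrt m\<close>, every element of the group has integers on one diagonal and integer multiples
  of \<open>sqrt m\<close> on the other. Its first column is therefore \<open>(x, y sqrt m)\<close> or \<open>(y sqrt m, x)\<close>, and
  determinant 1 reads \<open>a x - m b y = \<plusminus>1\<close> for integers \<open>a\<close>, \<open>b\<close>, which is the coprimality below.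
\<close>

definition twisted_primitive :: "nat \<Rightarrow> real \<Rightarrow> real \<Rightarrow> bool" where
  "twisted_primitive m u w \<longleftrightarrow>
     (\<exists>x y. coprime x (int m * y) \<and>
        ((u = of_int x \<and> w = sqrt m * of_int y) \<or> (u = sqrt m * of_int y \<and> w = of_int x)))"

lemma twisted_primitive_rotate:
  assumes "twisted_primitive m u w"
  shows "twisted_primitive m w (- u)"
proof -
  obtain x y where c: "coprime x (int m * y)" and
    "(u = of_int x \<and> w = sqrt m * of_int y) \<or> (u = sqrt m * of_int y \<and> w = of_int x)"
    using assms by (auto simp: twisted_primitive_def)
  then consider "u = of_int x" "w = sqrt m * of_int y" | "u = sqrt m * of_int y" "w = of_int x"
    by blast
  then show ?thesis
  proof cases
    case 1
    then show ?thesis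
      using c unfolding twisted_primitive_def by (intro exI[of _ "- x"] exI[of _ y]) auto
  next
    case 2
    then show ?thesis
      using c unfolding twisted_primitive_def by (intro exI[of _ x] exI[of _ "- y"]) auto
  qed
qed

lemma twisted_primitive_shear:
  assumes "twisted_primitive m u w"
  shows "twisted_primitive m (u + sqrt m * (of_int k * w)) w"
proof -
  obtain x y where c: "coprime x (int m * y)" and
    "(u = of_int x \<and> w = sqrt m * of_int y) \<or> (u = sqrt m * of_int y \<and> w = of_int x)"
    using assms by (auto simp: twisted_primitive_def)
  then consider "u = of_int x" "w = sqrt m * of_int y" | "u = sqrt m * of_int y" "w = of_int x"
    by blast
  then show ?thesis
  proof cases
    case 1
    have "coprime (x + int m * y * k) (int m * y)"
      using c by (metis coprime_iff_gcd_eq_1 gcd_add_mult gcd.commute mult.commute add.commute)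
    moreover have "u + sqrt m * (of_int k * w) = of_int (x + int m * y * k)"
      using 1 by (simp add: algebra_simps)
    ultimately show ?thesis
      using 1 unfolding twisted_primitive_def by blast
  next
    case 2
    have "coprime x (int m * (y + k * x))"
      using c by (metis coprime_iff_gcd_eq_1 gcd_add_mult coprime_mult_right_iff mult.commute add.commute)
    moreover have "u + sqrt m * (of_int k * w) = sqrt m * of_int (y + k * x)"
      using 2 by (simp add: algebra_simps)
    ultimately show ?thesis
      using 2 unfolding twisted_primitive_def by blast
  qed
qed

lemma twisted_primitive_norm_nat:
  assumes "twisted_primitive m u w"
  shows "\<exists>n::nat. u\<^sup>2 + w\<^sup>2 = real n"
proof -
  obtain x y where "(u = of_int x \<and> w = sqrt m * of_int y) \<or> (u = sqrt m * of_int y \<and> w = of_int x)"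
    using assms by (auto simp: twisted_primitive_def)
  then have "u\<^sup>2 + w\<^sup>2 = of_int (x\<^sup>2 + int m * y\<^sup>2)"
    by (auto simp: power_mult_distrib)
  also have "\<dots> = real (nat (x\<^sup>2 + int m * y\<^sup>2))"
    by simp
  finally show ?thesis ..
qed

lemma twisted_primitive_axis:
  assumes "twisted_primitive m u 0" "m \<ge> 2"
  shows "u = 1 \<or> u = - 1"
proof -
  obtain x y where c: "coprime x (int m * y)" and
    "(u = of_int x \<and> 0 = sqrt m * of_int y) \<or> (u = sqrt m * of_int y \<and> (0::real) = of_int x)"
    using assms(1) by (auto simp: twisted_primitive_def)
  then consider "u = of_int x" "y = 0" | "x = 0"
    using assms(2) by auto
  then show ?thesis
  proof cases
    case 1
    with c have "is_unit x" by simp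
    with 1 show ?thesis by auto
  next
    case 2
    with c have "int m dvd 1" by (auto dest: mult_unit_dvd_iff elim: dvd_mult_left simp: is_unit_mult_iff)
    with assms(2) show ?thesis by auto
  qed
qed

text \<open>
  This is one step of division with remainder of \<open>u\<close> by \<open>l w\<close>: the step is worth taking as long as
  \<open>u\<close> is not yet a remainder of least absolute value, that is, exceeds half the divisor.
\<close>

lemma shear_shortens:
  fixes l u w :: real
  assumes "w \<noteq> 0" "l > 0" "l * \<bar>w\<bar> < 2 * \<bar>u\<bar>"
  shows "(u + l * w)\<^sup>2 < u\<^sup>2 \<or> (u - l * w)\<^sup>2 < u\<^sup>2"
proof -
  have "l * \<bar>w\<bar> * (l * \<bar>w\<bar>) < 2 * \<bar>u\<bar> * (l * \<bar>w\<bar>)"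
    using assms by (intro mult_strict_right_mono) auto
  then have *: "(l * w)\<^sup>2 < 2 * l * \<bar>u * w\<bar>"
    by (simp add: power2_eq_square abs_mult mult.assoc mult.left_commute mult.commute)
  show ?thesis
  proof (cases "u * w \<ge> 0")
    case True
    then have "(u - l * w)\<^sup>2 < u\<^sup>2"
      using * by (simp add: power2_eq_square algebra_simps)
    then show ?thesis ..
  next
    case False
    then have "(u + l * w)\<^sup>2 < u\<^sup>2"
      using * by (simp add: power2_eq_square algebra_simps)
    then show ?thesis ..
  qed
qed

text \<open>
  The Euclidean descent. As long as both coordinates are nonzero, \<open>sqrt m < 2\<close> guarantees that the larger one
  exceeds \<open>sqrt m / 2\<close> times the other, so a shear, preceded by a quarter turn if necessary, decreases
  the squared length, which is a natural number. A vector on an axis is \<open>\<plusminus>e\<^sub>1\<close> or its quarter turn.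
\<close>

lemma twisted_primitive_in_hecke_orbit:
  assumes m: "2 \<le> m" "m < 4" and l: "hecke_lambda q = sqrt m"
    and "twisted_primitive m u w"
  shows "vector [u, w] \<in> hecke_orbit q"
proof -
  have l2: "0 < sqrt m" "sqrt m < 2"
    using m real_sqrt_less_mono[of m 4] by auto
  have unrotate: "vector [u, w] \<in> hecke_orbit q" if "vector [w, - u] \<in> hecke_orbit q" for u w
    using hecke_orbit_moves(2)[OF that] by simp
  have "\<forall>u w. twisted_primitive m u w \<longrightarrow> u\<^sup>2 + w\<^sup>2 = real n \<longrightarrow> vector [u, w] \<in> hecke_orbit q" for n
  proof (induction n rule: less_induct)
    case (less n)
    have shear: "vector [u, w] \<in> hecke_orbit q"
      if uw: "twisted_primitive m u w" "u\<^sup>2 + w\<^sup>2 = real n" "w \<noteq> 0" "sqrt m * \<bar>w\<bar> < 2 * \<bar>u\<bar>" for u w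
    proof -
      have pos: "twisted_primitive m (u + sqrt m * w) w" and neg: "twisted_primitive m (u - sqrt m * w) w"
        using twisted_primitive_shear[OF uw(1), of 1] twisted_primitive_shear[OF uw(1), of "-1"] by auto
      consider "(u + sqrt m * w)\<^sup>2 < u\<^sup>2" | "(u - sqrt m * w)\<^sup>2 < u\<^sup>2"
        using shear_shortens[OF uw(3) l2(1) uw(4)] by blast
      then show ?thesis
      proof cases
        case 1
        obtain k :: nat where k: "(u + sqrt m * w)\<^sup>2 + w\<^sup>2 = real k"
          using twisted_primitive_norm_nat[OF pos] by blast
        then have "k < n" using 1 uw(2) by linarith
        with less pos k have "vector [u + sqrt m * w, w] \<in> hecke_orbit q" by blast
        from hecke_orbit_moves(4)[OF this] show ?thesis by (simp add: l)
      next
        case 2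
        obtain k :: nat where k: "(u - sqrt m * w)\<^sup>2 + w\<^sup>2 = real k"
          using twisted_primitive_norm_nat[OF neg] by blast
        then have "k < n" using 2 uw(2) by linarith
        with less neg k have "vector [u - sqrt m * w, w] \<in> hecke_orbit q" by blast
        from hecke_orbit_moves(3)[OF this] show ?thesis by (simp add: l)
      qed
    qed
    have axis: "vector [u, 0] \<in> hecke_orbit q" if "twisted_primitive m u 0" for u
    proof -
      have "vector [- 1, 0] \<in> hecke_orbit q"
        using hecke_orbit_moves(1)[OF hecke_orbit_moves(1)[OF one_zero_in_hecke_orbit[of q]]] by simp
      then show ?thesis
        using twisted_primitive_axis[OF that m(1)] one_zero_in_hecke_orbit[of q] by auto
    qed
    show ?case
    proof (intro allI impI)
      fix u w
      assume uw: "twisted_primitive m u w" "u\<^sup>2 + w\<^sup>2 = real n"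
      have rot: "twisted_primitive m w (- u)" "w\<^sup>2 + (- u)\<^sup>2 = real n"
        using twisted_primitive_rotate[OF uw(1)] uw(2) by auto
      consider "w = 0" | "u = 0" | "u \<noteq> 0" "w \<noteq> 0" by blast
      then show "vector [u, w] \<in> hecke_orbit q"
      proof cases
        case 1
        then show ?thesis using axis uw(1) by simp
      next
        case 2
        then show ?thesis using axis rot(1) unrotate[of w 0] by simp
      next
        case 3
        show ?thesis
        proof (cases "sqrt m * \<bar>w\<bar> < 2 * \<bar>u\<bar>")
          case True
          then show ?thesis using shear uw 3 by blast
        next
          case False
          \<comment> \<open>Because \<open>sqrt m < 2\<close>, this forces \<open>\<bar>u\<bar> < \<bar>w\<bar>\<close>, so the rotated vector can be sheared.\<close>
          have "sqrt m * \<bar>w\<bar> < 2 * \<bar>w\<bar>" "sqrt m * \<bar>u\<bar> < 2 * \<bar>u\<bar>"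
            using l2 3 by auto
          then have "sqrt m * \<bar>- u\<bar> < 2 * \<bar>w\<bar>"
            using False by (auto simp: not_less)
          then show ?thesis using shear[OF rot] 3 unrotate by simp
        qed
      qed
    qed
  qed
  with assms(4) twisted_primitive_norm_nat[OF assms(4)] show ?thesis by blast
qed

lemma hecke_group_preserves_twisted_primitive:
  assumes "hecke_lambda q = sqrt m" "g \<in> hecke_group q" "twisted_primitive m (v $ 1) (v $ 2)"
  shows "twisted_primitive m ((g *v v) $ 1) ((g *v v) $ 2)"
proof -
  have vec: "v = vector [v $ 1, v $ 2]" for v :: "real^2"
    by (simp add: vec_eq_iff forall_2)
  have "\<forall>v. twisted_primitive m (v $ 1) (v $ 2) \<longrightarrow> twisted_primitive m ((g *v v) $ 1) ((g *v v) $ 2)"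
    using assms(2) unfolding hecke_group_def
  proof (induction rule: generate.induct)
    case one
    then show ?case by (simp add: SL2R_def)
  next
    case (incl h)
    show ?case
    proof (intro allI impI)
      fix v :: "real^2" assume v: "twisted_primitive m (v $ 1) (v $ 2)"
      show "twisted_primitive m ((h *v v) $ 1) ((h *v v) $ 2)"
        using incl twisted_primitive_rotate[OF v] twisted_primitive_shear[OF v, of 1]
        by (subst (1 2) vec[of v]) (auto simp: hecke_S_mult hecke_T_mult assms(1))
    qed
  next
    case (inv h)
    show ?case
    proof (intro allI impI)
      fix v :: "real^2" assume v: "twisted_primitive m (v $ 1) (v $ 2)"
      have "twisted_primitive m (- (v $ 2)) (v $ 1)"
        using twisted_primitive_rotate[OF twisted_primitive_rotate[OF twisted_primitive_rotate[OF v]]]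
        by simp
      then show "twisted_primitive m ((inv\<^bsub>SL2R\<^esub> h *v v) $ 1) ((inv\<^bsub>SL2R\<^esub> h *v v) $ 2)"
        using inv twisted_primitive_shear[OF v, of "-1"]
        by (subst (1 2) vec[of v]) (auto simp: inv_hecke_S_mult inv_hecke_T_mult assms(1))
    qed
  next
    case (eng h1 h2)
    then show ?case by (simp add: SL2R_def flip: matrix_vector_mul_assoc)
  qed
  with assms(3) show ?thesis by blast
qed

lemma hecke_orbit_eq:
  assumes "2 \<le> m" "m < 4" and l: "hecke_lambda q = sqrt m"
  shows "hecke_orbit q = {v. twisted_primitive m (v $ 1) (v $ 2)}"
proof (intro equalityI subsetI CollectI)
  fix v assume "v \<in> hecke_orbit q"
  then obtain g where g: "g \<in> hecke_group q" "v = g *v vector [1, 0]"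
    by (auto simp: hecke_orbit_def)
  have "twisted_primitive m 1 0"
    unfolding twisted_primitive_def by (intro exI[of _ 1] exI[of _ 0]) auto
  then show "twisted_primitive m (v $ 1) (v $ 2)"
    using hecke_group_preserves_twisted_primitive[OF l g(1), of "vector [1, 0]"] g(2) by simp
next
  fix v :: "real^2" assume "v \<in> {v. twisted_primitive m (v $ 1) (v $ 2)}"
  then have "vector [v $ 1, v $ 2] \<in> hecke_orbit q"
    using twisted_primitive_in_hecke_orbit[OF assms] by simp
  moreover have "vector [v $ 1, v $ 2] = v"
    by (simp add: vec_eq_iff forall_2)
  ultimately show "v \<in> hecke_orbit q" by simp
qed

section \<open>Recovering a limit from averages over dilations\<close>

text \<open>
  The term \<open>n = 0\<close> of the average is \<open>h R\<close> itself, and the remaining weights add up to \<open>W - 1 < 1\<close>.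
  If \<open>\<bar>h\<bar> \<le> l\<close> holds eventually, then the average with these weights is at most \<open>(W - 1) l\<close>, up to a tail
  that the global bound \<open>K\<close> makes small; so \<open>\<bar>h\<bar> \<le> k l\<close> holds eventually for any \<open>k > W - 1\<close>, and with \<open>k < 1\<close>
  iteration drives the bound to 0.
\<close>

lemma tendsto_0_of_dilation_average:
  fixes h :: "real \<Rightarrow> real" and w :: "nat \<Rightarrow> real"
  assumes w: "w sums W" "W < 2" "w 0 = 1" "\<And>n. 0 \<le> w n"
    and bounded: "\<And>R. R > 0 \<Longrightarrow> \<bar>h R\<bar> \<le> K"
    and average: "((\<lambda>R. \<Sum>n. w n * h (R / real (n + 1))) \<longlongrightarrow> 0) at_top"
  shows "(h \<longlongrightarrow> 0) at_top"
proof -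
  define t where "t = (\<lambda>n. w (Suc n))"
  \<comment> \<open>the midpoint of \<open>W - 1\<close> and \<open>1\<close>\<close>
  define k where "k = W / 2"
  have K: "K \<ge> 0" using bounded[of 1] by linarith
  have t: "t sums (W - 1)" "\<And>n. 0 \<le> t n"
    using w(1,3,4) sums_Suc_iff[of w "W - 1"] by (auto simp: t_def)
  have "0 \<le> W - 1"
    using t sums_le[OF _ sums_zero t(1)] by simp
  then have k: "W - 1 < k" "k < 1" "0 < k"
    using w(2) by (auto simp: k_def)
  have summ: "summable (\<lambda>n. t n * \<bar>h (R / real (n + 2))\<bar>)" if "R > 0" for R
    by (rule summable_comparison_test'[of "\<lambda>n. t n * K" 0])
       (use that bounded t in \<open>auto simp: abs_mult sums_iff intro!: mult_left_mono summable_mult2\<close>)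
  have split: "\<bar>h R\<bar> \<le> \<bar>\<Sum>n. w n * h (R / real (n + 1))\<bar> + (\<Sum>n. t n * \<bar>h (R / real (n + 2))\<bar>)"
    if R: "R > 0" for R
  proof -
    have s: "summable (\<lambda>n. \<bar>t n * h (R / real (n + 2))\<bar>)"
      using summ[OF R] t(2) by (simp add: abs_mult)
    then have "summable (\<lambda>n. w (Suc n) * h (R / real (Suc n + 1)))"
      using summable_rabs_cancel by (fastforce simp: t_def)
    then have "summable (\<lambda>n. w n * h (R / real (n + 1)))"
      by (subst (asm) summable_Suc_iff)
    from suminf_split_head[OF this]
    have "(\<Sum>n. w n * h (R / real (n + 1))) = h R + (\<Sum>n. t n * h (R / real (n + 2)))"
      by (simp add: t_def w(3))
    moreover have "\<bar>\<Sum>n. t n * h (R / real (n + 2))\<bar> \<le> (\<Sum>n. t n * \<bar>h (R / real (n + 2))\<bar>)"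
      using summable_rabs[OF s] t(2) by (simp add: abs_mult)
    ultimately show ?thesis by linarith
  qed
  have improve: "\<forall>\<^sub>F R in at_top. \<bar>h R\<bar> \<le> (W - 1) * l + d"
    if l: "\<forall>\<^sub>F R in at_top. \<bar>h R\<bar> \<le> l" "l \<ge> 0" and d: "d > 0" for l d
  proof -
    have "summable (\<lambda>n. t n * K)"
      using t by (auto simp: sums_iff intro: summable_mult2)
    then obtain N where "\<forall>n\<ge>N. norm (\<Sum>i. t (i + n) * K) < d / 2"
      using suminf_exist_split[of "d / 2" "\<lambda>n. t n * K"] d by auto
    then have "norm (\<Sum>i. t (i + N) * K) < d / 2"
      by blast
    then have N: "(\<Sum>i. t (i + N) * K) < d / 2"
      by simp
    have near: "\<forall>\<^sub>F R in at_top. \<forall>n\<in>{..<N}. \<bar>h (R / real (n + 2))\<bar> \<le> l"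
    proof (rule eventually_ball_finite)
      show "\<forall>n\<in>{..<N}. \<forall>\<^sub>F R in at_top. \<bar>h (R / real (n + 2))\<bar> \<le> l"
      proof
        fix n
        have "filterlim (\<lambda>R::real. R / real (n + 2)) at_top at_top"
          by real_asymp
        with l(1) show "\<forall>\<^sub>F R in at_top. \<bar>h (R / real (n + 2))\<bar> \<le> l"
          by (rule eventually_compose_filterlim)
      qed
    qed simp
    have small: "\<forall>\<^sub>F R in at_top. \<bar>\<Sum>n. w n * h (R / real (n + 1))\<bar> < d / 2"
      using tendstoD[OF average, of "d / 2"] d by simp
    show ?thesis
      using near small eventually_gt_at_top[of 0]
    proof eventually_elim
      case (elim R)
      have "(\<Sum>n. t n * \<bar>h (R / real (n + 2))\<bar>) =
          (\<Sum>i. t (i + N) * \<bar>h (R / real (i + N + 2))\<bar>) + (\<Sum>n<N. t n * \<bar>h (R / real (n + 2))\<bar>)"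
        using suminf_split_initial_segment[OF summ[OF elim(3)], of N] by simp
      also have "(\<Sum>i. t (i + N) * \<bar>h (R / real (i + N + 2))\<bar>) \<le> (\<Sum>i. t (i + N) * K)"
      proof (rule suminf_le)
        show "t (i + N) * \<bar>h (R / real (i + N + 2))\<bar> \<le> t (i + N) * K" for i
          using elim(3) t(2) by (intro mult_left_mono bounded) auto
        show "summable (\<lambda>i. t (i + N) * \<bar>h (R / real (i + N + 2))\<bar>)"
          using summable_ignore_initial_segment[OF summ[OF elim(3)], of N] by simp
        show "summable (\<lambda>i. t (i + N) * K)"
          using t by (auto simp: sums_iff intro: summable_mult2 summable_ignore_initial_segment)
      qed
      also have "(\<Sum>n<N. t n * \<bar>h (R / real (n + 2))\<bar>) \<le> (\<Sum>n<N. t n * l)"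
        using elim(1) t(2) by (intro sum_mono mult_left_mono) auto
      also have "\<dots> = (\<Sum>n<N. t n) * l"
        by (simp add: sum_distrib_right)
      also have "\<dots> \<le> (W - 1) * l"
        using t l(2) sum_le_suminf[of t "{..<N}"] by (intro mult_right_mono) (auto simp: sums_iff)
      finally show ?case
        using split[OF elim(3)] elim(2) N by linarith
    qed
  qed
  have geometric: "\<forall>\<^sub>F R in at_top. \<bar>h R\<bar> \<le> (K + 1) * k ^ n" for n
  proof (induction n)
    case 0
    show ?case
      using eventually_gt_at_top[of 0]
    proof eventually_elim
      case (elim R)
      then show ?case using bounded[of R] by simp
    qed
  next
    case (Suc n)
    have pos: "(K + 1) * k ^ n > 0" using K k by simp
    \<comment> \<open>The admissible tail is exactly the gap between the factors \<open>W - 1\<close> and \<open>k\<close>.\<close>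
    from improve[OF Suc, of "(k - (W - 1)) * ((K + 1) * k ^ n)"] k pos
    have "\<forall>\<^sub>F R in at_top. \<bar>h R\<bar> \<le> (W - 1) * ((K + 1) * k ^ n) + (k - (W - 1)) * ((K + 1) * k ^ n)"
      by simp
    then show ?case by (simp add: algebra_simps)
  qed
  show ?thesis
  proof (rule tendstoI)
    fix e :: real assume "e > 0"
    have "(\<lambda>n. (K + 1) * k ^ n) \<longlonglongrightarrow> (K + 1) * 0"
      using k by (intro tendsto_mult tendsto_const LIMSEQ_realpow_zero) auto
    then have "\<forall>\<^sub>F n in sequentially. (K + 1) * k ^ n < e"
      using \<open>e > 0\<close> by (auto dest: order_tendstoD)
    then obtain n where "(K + 1) * k ^ n < e"
      by (auto simp: eventually_sequentially)
    with geometric[of n] show "\<forall>\<^sub>F R in at_top. dist (h R) 0 < e"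
      by (auto elim: eventually_mono)
  qed
qed

lemma tendsto_of_dilation_average:
  fixes f :: "real \<Rightarrow> real" and w :: "nat \<Rightarrow> real"
  assumes w: "w sums W" "W < 2" "w 0 = 1" "\<And>n. 0 \<le> w n"
    and bounded: "\<And>R. R > 0 \<Longrightarrow> \<bar>f R\<bar> \<le> K"
    and average: "((\<lambda>R. \<Sum>n. w n * f (R / real (n + 1))) \<longlongrightarrow> c) at_top"
  shows "(f \<longlongrightarrow> c / W) at_top"
proof -
  have "W \<ge> 1"
    using w sum_le_suminf[of w "{0}"] by (auto simp: sums_iff)
  have "((\<lambda>R. f R - c / W) \<longlongrightarrow> 0) at_top"
  proof (rule tendsto_0_of_dilation_average[OF w])
    show "\<bar>f R - c / W\<bar> \<le> K + \<bar>c / W\<bar>" if "R > 0" for R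
      using bounded[OF that] by linarith
    have eq: "(\<Sum>n. w n * (f (R / real (n + 1)) - c / W)) = (\<Sum>n. w n * f (R / real (n + 1))) - c"
      if "R > 0" for R
    proof -
      have "summable (\<lambda>n. w n * f (R / real (n + 1)))"
        by (rule summable_comparison_test'[of "\<lambda>n. w n * K" 0])
           (use that bounded w in \<open>auto simp: abs_mult sums_iff intro!: mult_left_mono summable_mult2\<close>)
      moreover have "(\<lambda>n. w n * (c / W)) sums (W * (c / W))"
        using w(1) by (rule sums_mult2)
      ultimately have "(\<lambda>n. w n * f (R / real (n + 1)) - w n * (c / W)) sums
          ((\<Sum>n. w n * f (R / real (n + 1))) - W * (c / W))"
        by (intro sums_diff summable_sums)
      then show ?thesis
        using \<open>W \<ge> 1\<close> by (auto simp: right_diff_distrib sums_iff)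
    qed
    have "((\<lambda>R. (\<Sum>n. w n * f (R / real (n + 1))) - c) \<longlongrightarrow> 0) at_top"
      using tendsto_diff[OF average tendsto_const[of c]] by simp
    then show "((\<lambda>R. \<Sum>n. w n * (f (R / real (n + 1)) - c / W)) \<longlongrightarrow> 0) at_top"
    proof (rule Lim_transform_eventually)
      show "\<forall>\<^sub>F R in at_top. (\<Sum>n. w n * f (R / real (n + 1))) - c =
          (\<Sum>n. w n * (f (R / real (n + 1)) - c / W))"
        using eventually_gt_at_top[of 0] by eventually_elim (rule eq [symmetric])
    qed
  qed
  from tendsto_add[OF this tendsto_const[of "c / W"]] show ?thesis by simp
qed

text \<open>
  The multiples of \<open>m\<close> contribute \<open>1 / m\<^sup>2\<close> of the full sum \<open>\<pi>\<^sup>2 / 6\<close>, by scaling. For prime \<open>m\<close>, the factor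
  \<open>1 - 1 / m\<^sup>2\<close> removes the Euler factor at \<open>m\<close> from \<open>\<zeta>(2)\<close>.
\<close>

lemma sums_inverse_squares_nondivisible:
  assumes "m > 0"
  shows "(\<lambda>n. if m dvd n + 1 then 0 else 1 / (real (n + 1))\<^sup>2) sums ((1 - 1 / (real m)\<^sup>2) * (pi\<^sup>2 / 6))"
proof -
  \<comment> \<open>As the series starts at \<open>n + 1 = 1\<close>, the multiples of \<open>m\<close> sit at these positions.\<close>
  define g where "g n = m * (n + 1) - 1" for n
  define b where "b n = (if m dvd n + 1 then 1 / (real (n + 1))\<^sup>2 else 0)" for n
  have g1: "g n + 1 = m * (n + 1)" for n
    using assms by (simp add: g_def)
  have "strict_mono g"
  proof (rule strict_monoI)
    fix i j :: nat assume "i < j"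
    with assms have "m * (i + 1) < m * (j + 1)" by simp
    then show "g i < g j" using g1[of i] g1[of j] by linarith
  qed
  moreover have "b n = 0" if "n \<notin> range g" for n
  proof -
    have "\<not> m dvd n + 1"
    proof
      assume "m dvd n + 1"
      then obtain k where k: "n + 1 = m * k" by (elim dvdE)
      then have "k > 0" by (cases k) auto
      with k g1[of "k - 1"] have "n = g (k - 1)" by simp
      with that show False by blast
    qed
    then show ?thesis by (simp add: b_def)
  qed
  moreover have "(\<lambda>n. b (g n)) sums (1 / (real m)\<^sup>2 * (pi\<^sup>2 / 6))"
  proof -
    have "b (g n) = 1 / (real m)\<^sup>2 * (1 / (real n + 1)\<^sup>2)" for n
      unfolding b_def g1 by (simp add: power_mult_distrib add.commute del: distrib_left_numeral mult_Suc_right flip: of_nat_Suc)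
    then show ?thesis
      using sums_mult[OF inverse_squares_sums, of "1 / (real m)\<^sup>2"] by (simp add: add.commute)
  qed
  ultimately have "b sums (1 / (real m)\<^sup>2 * (pi\<^sup>2 / 6))"
    by (simp add: sums_mono_reindex)
  from sums_diff[OF inverse_squares_sums this]
  have "(\<lambda>n. 1 / (real n + 1)\<^sup>2 - b n) sums ((1 - 1 / (real m)\<^sup>2) * (pi\<^sup>2 / 6))"
    by (simp add: algebra_simps diff_divide_distrib)
  moreover have "(\<lambda>n. 1 / (real n + 1)\<^sup>2 - b n) = (\<lambda>n. if m dvd n + 1 then 0 else 1 / (real (n + 1))\<^sup>2)"
    by (auto simp: b_def add.commute)
  ultimately show ?thesis by simp
qed

section \<open>Counting the lattice points\<close>

definition twisted_primitive_points :: "nat \<Rightarrow> real \<Rightarrow> (int \<times> int) set" where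
  "twisted_primitive_points m R =
     {(x, y). coprime x (int m * y) \<and> \<bar>of_int x\<bar> \<le> R \<and> sqrt m * \<bar>of_int y\<bar> \<le> R}"

definition nondivisible_points :: "nat \<Rightarrow> real \<Rightarrow> (int \<times> int) set" where
  "nondivisible_points m R =
     {(x, y). \<not> int m dvd x \<and> \<bar>of_int x\<bar> \<le> R \<and> sqrt m * \<bar>of_int y\<bar> \<le> R}"

lemma bounded_ints_eq: "{x::int. \<bar>of_int x\<bar> \<le> (R::real)} = {- \<lfloor>R\<rfloor>..\<lfloor>R\<rfloor>}"
  by (auto simp: abs_le_iff) linarith+

lemma card_bounded_ints: "R \<ge> 0 \<Longrightarrow> real (card {x::int. \<bar>of_int x\<bar> \<le> (R::real)}) = 2 * \<lfloor>R\<rfloor> + 1"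
  by (simp add: bounded_ints_eq)

lemma finite_bounded_ints: "finite {x::int. \<bar>of_int x\<bar> \<le> (R::real)}"
  by (simp add: bounded_ints_eq)

lemma nondivisible_points_eq_Times:
  assumes "m > 0"
  shows "nondivisible_points m R =
     ({x. \<bar>of_int x\<bar> \<le> R} - (*) (int m) ` {x. \<bar>of_int x\<bar> \<le> R / m}) \<times> {y. \<bar>of_int y\<bar> \<le> R / sqrt m}"
  using assms
  by (auto simp: nondivisible_points_def field_simps abs_mult elim!: dvdE)

lemma finite_nondivisible_points: "m > 0 \<Longrightarrow> finite (nondivisible_points m R)"
  by (auto simp: nondivisible_points_eq_Times intro: finite_bounded_ints)

lemma card_nondivisible_points:
  assumes "m > 0" "R \<ge> 0"
  shows "real (card (nondivisible_points m R)) = (2 * \<lfloor>R\<rfloor> - 2 * \<lfloor>R / m\<rfloor>) * (2 * \<lfloor>R / sqrt m\<rfloor> + 1)"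
proof -
  let ?M = "(*) (int m) ` {x. \<bar>of_int x\<bar> \<le> R / m}"
  have inj: "inj_on ((*) (int m)) A" for A
    using assms by (auto intro: inj_onI)
  have sub: "?M \<subseteq> {x. \<bar>of_int x\<bar> \<le> R}"
    using assms by (auto simp: abs_mult field_simps)
  have "real (card ({x. \<bar>of_int x\<bar> \<le> R} - ?M)) = real (card {x::int. \<bar>of_int x\<bar> \<le> R}) - real (card ?M)"
    using sub card_mono[OF finite_bounded_ints sub] finite_subset[OF sub finite_bounded_ints]
    by (simp add: card_Diff_subset of_nat_diff)
  also have "\<dots> = 2 * \<lfloor>R\<rfloor> - 2 * \<lfloor>R / m\<rfloor>"
    using assms by (simp add: card_image[OF inj] card_bounded_ints)
  finally show ?thesis
    using assms by (simp add: nondivisible_points_eq_Times card_cartesian_product card_bounded_ints)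
qed

lemma nondivisible_points_density:
  assumes "m > 0"
  shows "((\<lambda>R. real (card (nondivisible_points m R)) / R\<^sup>2) \<longlongrightarrow> 4 * (1 - 1 / m) / sqrt m) at_top"
proof -
  have fl: "((\<lambda>R::real. \<lfloor>R * a\<rfloor> / R) \<longlongrightarrow> a) at_top" if "a > 0" for a :: real
    using that by real_asymp
  have "((\<lambda>R::real. (2 * (\<lfloor>R * 1\<rfloor> / R) - 2 * (\<lfloor>R * (1 / m)\<rfloor> / R)) *
            (2 * (\<lfloor>R * (1 / sqrt m)\<rfloor> / R) + 1 / R))
        \<longlongrightarrow> (2 * 1 - 2 * (1 / m)) * (2 * (1 / sqrt m) + 0)) at_top"
    using assms by (intro tendsto_intros fl) (simp_all, real_asymp)
  also have "(2 * 1 - 2 * (1 / m)) * (2 * (1 / sqrt m) + 0) = 4 * (1 - 1 / m) / sqrt m"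
    by (simp add: algebra_simps add_divide_distrib diff_divide_distrib)
  finally show ?thesis
  proof (rule Lim_transform_eventually)
    show "\<forall>\<^sub>F R in at_top. (2 * (\<lfloor>R * 1\<rfloor> / R) - 2 * (\<lfloor>R * (1 / m)\<rfloor> / R)) *
        (2 * (\<lfloor>R * (1 / sqrt m)\<rfloor> / R) + 1 / R) = real (card (nondivisible_points m R)) / R\<^sup>2"
      using eventually_gt_at_top[of 0]
      by eventually_elim (simp add: assms card_nondivisible_points power2_eq_square field_simps)
  qed
qed

lemma coprime_prime_mult_iff:
  assumes "prime m"
  shows "coprime x (int m * y) \<longleftrightarrow> \<not> int m dvd x \<and> coprime x y"
proof -
  have "coprime x (int m) \<longleftrightarrow> \<not> int m dvd x"
    using assms prime_imp_coprime[of "int m" x] coprime_absorb_left[of "int m" x]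
    by (auto simp: coprime_commute dest: prime_gt_1_nat)
  then show ?thesis by (simp add: coprime_mult_right_iff)
qed

text \<open>
  Dividing by the gcd \<open>d\<close> turns a gcd class into primitive points of a rectangle shrunk by \<open>d\<close>. The
  condition \<open>\<not> m dvd x\<close> passes to the quotient precisely because \<open>m\<close> is a prime not dividing \<open>d\<close>, and it rules out
  all \<open>d\<close> divisible by \<open>m\<close>.
\<close>

lemma card_gcd_class:
  assumes "prime m" "d > 0"
  shows "card {p \<in> nondivisible_points m R. gcd (fst p) (snd p) = int d} =
    (if m dvd d then 0 else card (twisted_primitive_points m (R / d)))"
proof (cases "m dvd d")
  case True
  have "int m dvd x" if "gcd x y = int d" for x y
    using True that by (metis dvd_trans gcd_dvd1 int_dvd_int_iff)
  then have "{p \<in> nondivisible_points m R. gcd (fst p) (snd p) = int d} = {}"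
    by (auto simp: nondivisible_points_def)
  then show ?thesis
    by (simp only: card.empty True if_True)
next
  case False
  let ?s = "\<lambda>(x, y). (int d * x, int d * y)"
  have dvd_iff: "int m dvd int d * x \<longleftrightarrow> int m dvd x" for x
    using False assms(1) by (simp add: prime_dvd_mult_iff)
  have gcd_iff: "gcd (int d * x) (int d * y) = int d \<longleftrightarrow> coprime x y" for x y
    using assms(2) by (simp add: gcd_mult_distrib_int[symmetric] coprime_iff_gcd_eq_1 abs_if)
  have mem: "?s (x, y) \<in> {p \<in> nondivisible_points m R. gcd (fst p) (snd p) = int d} \<longleftrightarrow>
      (x, y) \<in> twisted_primitive_points m (R / d)" for x y
  proof -
    have "\<bar>of_int (int d * x)\<bar> \<le> R \<longleftrightarrow> \<bar>of_int x\<bar> \<le> R / d"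
      and "sqrt m * \<bar>of_int (int d * y)\<bar> \<le> R \<longleftrightarrow> sqrt m * \<bar>of_int y\<bar> \<le> R / d"
      using assms(2) by (simp_all add: abs_mult field_simps)
    then show ?thesis
      unfolding nondivisible_points_def twisted_primitive_points_def
      by (simp only: mem_Collect_eq prod.case fst_conv snd_conv dvd_iff gcd_iff
          coprime_prime_mult_iff[OF assms(1)]) blast
  qed
  have "{p \<in> nondivisible_points m R. gcd (fst p) (snd p) = int d} =
      ?s ` twisted_primitive_points m (R / d)"
  proof (intro equalityI subsetI)
    fix p assume p: "p \<in> {p \<in> nondivisible_points m R. gcd (fst p) (snd p) = int d}"
    then have "int d dvd fst p" "int d dvd snd p"
      by (metis (lifting) gcd_dvd1 mem_Collect_eq, metis (lifting) gcd_dvd2 mem_Collect_eq)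
    then obtain x y where xy: "p = ?s (x, y)"
      by (metis (no_types, lifting) case_prod_conv dvd_def prod.collapse)
    with p mem have "(x, y) \<in> twisted_primitive_points m (R / d)" by blast
    with xy show "p \<in> ?s ` twisted_primitive_points m (R / d)" by blast
  next
    fix p assume "p \<in> ?s ` twisted_primitive_points m (R / d)"
    then obtain x y where "p = ?s (x, y)" "(x, y) \<in> twisted_primitive_points m (R / d)"
      by auto
    with mem show "p \<in> {p \<in> nondivisible_points m R. gcd (fst p) (snd p) = int d}" by blast
  qed
  moreover have "inj_on ?s A" for A
    using assms(2) by (auto intro!: inj_onI)
  ultimately show ?thesis
    using False by (simp add: card_image)
qed

lemma twisted_primitive_points_subset_box:
  assumes "m > 0"
  shows "twisted_primitive_points m R \<subseteq> {x. \<bar>of_int x\<bar> \<le> R} \<times> {y. \<bar>of_int y\<bar> \<le> R}"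
proof -
  have "sqrt m * \<bar>r\<bar> \<ge> \<bar>r\<bar>" for r :: real
    using assms mult_right_mono[of 1 "sqrt m" "\<bar>r\<bar>"] by simp
  then show ?thesis
    by (fastforce simp: twisted_primitive_points_def intro: order_trans)
qed

lemma finite_twisted_primitive_points: "m > 0 \<Longrightarrow> finite (twisted_primitive_points m R)"
  by (rule finite_subset[OF twisted_primitive_points_subset_box]) (auto intro: finite_bounded_ints)

lemma twisted_primitive_points_empty:
  assumes "prime m" "R < 1"
  shows "twisted_primitive_points m R = {}"
proof -
  have "x \<noteq> 0" if "coprime x (int m * y)" for x y
    using that assms(1) by (auto simp: coprime_prime_mult_iff)
  then have "\<bar>real_of_int x\<bar> \<ge> 1" if "coprime x (int m * y)" for x y
    using that by (fastforce simp flip: of_int_abs)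
  with assms(2) show ?thesis
    by (force simp: twisted_primitive_points_def)
qed

text \<open>
  The averaging argument evaluates \<open>P(R / d) / (R / d)\<^sup>2\<close> at all positive arguments, however
  small, so a bound is required there as well; near 0 it holds since there are no points.
\<close>

lemma card_twisted_primitive_points_le:
  assumes "prime m" "R > 0"
  shows "real (card (twisted_primitive_points m R)) \<le> 9 * R\<^sup>2"
proof (cases "R < 1")
  case True
  then show ?thesis using assms by (simp add: twisted_primitive_points_empty)
next
  case False
  have m: "m > 0" using assms(1) by (simp add: prime_gt_0_nat)
  have "real (card (twisted_primitive_points m R)) \<le>
      real (card ({x::int. \<bar>of_int x\<bar> \<le> R} \<times> {y::int. \<bar>of_int y\<bar> \<le> R}))"
    by (intro of_nat_mono card_mono twisted_primitive_points_subset_box m finite_cartesian_product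
        finite_bounded_ints)
  also have "\<dots> = (2 * of_int \<lfloor>R\<rfloor> + 1)\<^sup>2"
    using assms by (simp add: card_cartesian_product card_bounded_ints power2_eq_square)
  also have "\<dots> \<le> (3 * R)\<^sup>2"
    using False by (intro power_mono; linarith)
  finally show ?thesis by (simp add: power_mult_distrib)
qed

text \<open>
  Only finitely many terms are nonzero: \<open>\<not> m dvd x\<close> forces \<open>x \<noteq> 0\<close>, so the gcd is at most \<open>\<bar>x\<bar> \<le> R\<close>.
\<close>

lemma sums_card_twisted_primitive_points:
  assumes "prime m"
  shows "(\<lambda>n. if m dvd n + 1 then 0 else real (card (twisted_primitive_points m (R / real (n + 1)))))
     sums real (card (nondivisible_points m R))"
proof -
  have m: "m > 0" using assms by (simp add: prime_gt_0_nat)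
  define N where "N = nat \<lceil>R\<rceil>"
  let ?c = "\<lambda>n. card {p \<in> nondivisible_points m R. gcd (fst p) (snd p) = int (n + 1)}"
  let ?g = "\<lambda>p::int \<times> int. nat (gcd (fst p) (snd p)) - 1"
  have g: "gcd (fst p) (snd p) = int (?g p + 1)" "?g p < N" if p: "p \<in> nondivisible_points m R" for p
  proof -
    obtain x y where xy: "p = (x, y)" by (cases p)
    have x: "x \<noteq> 0" "\<bar>of_int x\<bar> \<le> R"
      using p xy by (auto simp: nondivisible_points_def)
    then have "gcd x y > 0" by simp
    moreover have "gcd x y \<le> \<bar>x\<bar>"
      using x(1) by (simp add: zdvd_imp_le)
    moreover have "\<bar>x\<bar> \<le> \<lceil>R\<rceil>"
      using x(2) by linarith
    ultimately show "gcd (fst p) (snd p) = int (?g p + 1)" "?g p < N"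
      unfolding xy N_def fst_conv snd_conv by linarith+
  qed
  have fibre: "{p \<in> nondivisible_points m R. gcd (fst p) (snd p) = int (n + 1)} =
      {p \<in> nondivisible_points m R. ?g p = n}" for n
    using g(1) by force
  have "(\<lambda>n. real (?c n)) sums (\<Sum>n<N. real (?c n))"
  proof (rule sums_finite)
    fix n assume "n \<notin> {..<N}"
    then have "{p \<in> nondivisible_points m R. ?g p = n} = {}"
      using g(2) by auto
    then show "real (?c n) = 0" unfolding fibre by (simp only: card.empty of_nat_0)
  qed simp
  also have "(\<Sum>n<N. real (?c n)) = real (card (nondivisible_points m R))"
    unfolding fibre
    using sum.group[of "nondivisible_points m R" "{..<N}" ?g "\<lambda>_. 1::real"] g(2) m
    by (simp add: finite_nondivisible_points image_subset_iff)
  also have "(\<lambda>n. real (?c n)) =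
      (\<lambda>n. if m dvd n + 1 then 0 else real (card (twisted_primitive_points m (R / real (n + 1)))))"
  proof
    fix n :: nat
    have "0 < n + 1" by simp
    from card_gcd_class[OF assms this, of R]
    show "real (?c n) =
        (if m dvd n + 1 then 0 else real (card (twisted_primitive_points m (R / real (n + 1)))))"
      by (simp only: if_distrib[of real] of_nat_0)
  qed
  finally show ?thesis .
qed

lemma twisted_primitive_points_density:
  assumes "prime m"
  shows "((\<lambda>R. real (card (twisted_primitive_points m R)) / R\<^sup>2) \<longlongrightarrow>
           24 * sqrt m / ((real m + 1) * pi\<^sup>2)) at_top"
proof -
  have m: "m \<ge> 2" "real m > 1" using assms prime_ge_2_nat[of m] by auto
  define f where "f R = real (card (twisted_primitive_points m R)) / R\<^sup>2" for R
  define w where "w n = (if m dvd n + 1 then 0 else 1 / (real (n + 1))\<^sup>2)" for n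
  define W where "W = (1 - 1 / (real m)\<^sup>2) * (pi\<^sup>2 / 6)"
  have w: "w sums W"
    using sums_inverse_squares_nondivisible[of m] m unfolding w_def W_def by linarith
  \<comment> \<open>Any upper bound for \<open>\<pi>\<close> below \<open>sqrt 12\<close> gives \<open>\<pi>\<^sup>2 / 6 < 2\<close>.\<close>
  have "pi\<^sup>2 \<le> (16 / 5)\<^sup>2"
    using pi_approx by (intro power_mono) auto
  moreover have "W \<le> 1 * (pi\<^sup>2 / 6)"
    unfolding W_def by (intro mult_right_mono) auto
  ultimately have "W < 2"
    by (simp add: power2_eq_square)
  have eq: "(\<Sum>n. w n * f (R / real (n + 1))) = real (card (nondivisible_points m R)) / R\<^sup>2"
    if "R > 0" for R
  proof -
    have "(\<lambda>n. w n * f (R / real (n + 1))) =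
       (\<lambda>n. (if m dvd n + 1 then 0 else real (card (twisted_primitive_points m (R / real (n + 1))))) / R\<^sup>2)"
      by (auto simp: w_def f_def power_divide fun_eq_iff simp del: of_nat_add of_nat_Suc)
    then show ?thesis
      using sums_divide[OF sums_card_twisted_primitive_points[OF assms, of R], of "R\<^sup>2"]
      by (simp add: sums_iff)
  qed
  have "(f \<longlongrightarrow> (4 * (1 - 1 / m) / sqrt m) / W) at_top"
  proof (rule tendsto_of_dilation_average[OF w \<open>W < 2\<close>])
    show "w 0 = 1" "0 \<le> w n" for n
      using m by (auto simp: w_def)
    show "\<bar>f R\<bar> \<le> 9" if "R > 0" for R
      using card_twisted_primitive_points_le[OF assms that] that by (simp add: f_def field_simps)
    show "((\<lambda>R. \<Sum>n. w n * f (R / real (n + 1))) \<longlongrightarrow> 4 * (1 - 1 / m) / sqrt m) at_top"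
    proof (rule Lim_transform_eventually)
      show "((\<lambda>R. real (card (nondivisible_points m R)) / R\<^sup>2) \<longlongrightarrow> 4 * (1 - 1 / m) / sqrt m) at_top"
        using nondivisible_points_density m by simp
      show "\<forall>\<^sub>F R in at_top. real (card (nondivisible_points m R)) / R\<^sup>2 = (\<Sum>n. w n * f (R / real (n + 1)))"
        using eventually_gt_at_top[of 0] by eventually_elim (rule eq [symmetric])
    qed
  qed
  also have "(4 * (1 - 1 / m) / sqrt m) / W = 24 * sqrt m / ((real m + 1) * pi\<^sup>2)"
  proof -
    \<comment> \<open>With \<open>s = sqrt m\<close> both sides are rational functions of one variable.\<close>
    define s where "s = sqrt m"
    have s: "s > 1" "real m = s\<^sup>2"
      using m by (auto simp: s_def)
    have s2: "s\<^sup>2 > 1" using m s by simp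
    have "1 - 1 / s ^ 4 = (1 - 1 / s\<^sup>2) * (1 + 1 / s\<^sup>2)"
      by (simp add: algebra_simps flip: power_add)
    moreover have "1 - 1 / s\<^sup>2 \<noteq> 0"
      using s2 by simp
    moreover have "4 * a / s / (a * b * c) = 4 / s / (b * c)" if "a \<noteq> 0" for a b c :: real
      using that by simp
    ultimately have "(4 * (1 - 1 / s\<^sup>2) / s) / ((1 - 1 / s ^ 4) * (pi\<^sup>2 / 6)) =
        4 / s / ((1 + 1 / s\<^sup>2) * (pi\<^sup>2 / 6))"
      by (simp only:)
    also have "\<dots> = 24 * s / ((s\<^sup>2 + 1) * pi\<^sup>2)"
      using s s2 by (simp add: field_simps power2_eq_square)
    finally show ?thesis
      using abs_of_pos[of s] s(1) by (simp add: W_def s(2) flip: power_mult)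
  qed
  finally show ?thesis by (simp add: f_def)
qed

section \<open>The density of the orbit\<close>

text \<open>
  The vectors \<open>(x, y sqrt m)\<close> and their reflections are different sets: \<open>x = y' sqrt m\<close> would give
  \<open>m dvd x\<^sup>2\<close>, contradicting the coprimality of \<open>x\<close> and \<open>m\<close>.
\<close>

lemma card_hecke_orbit_square:
  assumes m: "prime m" "m < 4" and l: "hecke_lambda q = sqrt m"
  shows "card (hecke_orbit q \<inter> square R) = 2 * card (twisted_primitive_points m R)"
proof -
  have m2: "m \<ge> 2" using m(1) by (rule prime_ge_2_nat)
  let ?a = "\<lambda>(x, y). vector [of_int x, sqrt m * of_int y] :: real^2"
  let ?b = "\<lambda>(x, y). vector [sqrt m * of_int y, of_int x] :: real^2"
  let ?P = "twisted_primitive_points m R"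
  have "hecke_orbit q \<inter> square R = ?a ` ?P \<union> ?b ` ?P"
  proof (intro equalityI subsetI)
    fix v assume v: "v \<in> hecke_orbit q \<inter> square R"
    then obtain x y where c: "coprime x (int m * y)" and
      "(v $ 1 = of_int x \<and> v $ 2 = sqrt m * of_int y) \<or> (v $ 1 = sqrt m * of_int y \<and> v $ 2 = of_int x)"
      by (auto simp: hecke_orbit_eq[OF m2 m(2) l] twisted_primitive_def)
    then consider "v = ?a (x, y)" | "v = ?b (x, y)"
      by (auto simp: vec_eq_iff forall_2)
    then show "v \<in> ?a ` ?P \<union> ?b ` ?P"
    proof cases
      case 1
      with v c have "(x, y) \<in> ?P"
        by (auto simp: square_def forall_2 twisted_primitive_points_def abs_le_iff abs_mult_pos')
      with 1 show ?thesis by blast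
    next
      case 2
      with v c have "(x, y) \<in> ?P"
        by (auto simp: square_def forall_2 twisted_primitive_points_def abs_le_iff abs_mult_pos')
      with 2 show ?thesis by blast
    qed
  next
    fix v assume "v \<in> ?a ` ?P \<union> ?b ` ?P"
    then obtain x y where xy: "(x, y) \<in> ?P" "v = ?a (x, y) \<or> v = ?b (x, y)"
      by auto
    then have "twisted_primitive m (v $ 1) (v $ 2)"
      unfolding twisted_primitive_def by (intro exI[of _ x] exI[of _ y]) (auto simp: twisted_primitive_points_def)
    with xy show "v \<in> hecke_orbit q \<inter> square R"
      by (auto simp: hecke_orbit_eq[OF m2 m(2) l] square_def forall_2
          twisted_primitive_points_def abs_le_iff abs_mult_pos')
  qed
  moreover have "?a ` ?P \<inter> ?b ` ?P = {}"
  proof -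
    have irrational: "real_of_int x \<noteq> sqrt m * of_int y'" if "coprime x (int m * y)" for x y y'
    proof
      assume eq: "real_of_int x = sqrt m * of_int y'"
      have "real_of_int (x\<^sup>2) = of_int (int m * y'\<^sup>2)"
        using eq by (simp add: power_mult_distrib)
      then have "int m dvd x\<^sup>2"
        unfolding of_int_eq_iff by simp
      then have "int m dvd x"
        using m(1) by (simp add: prime_dvd_power_iff)
      with that show False unfolding coprime_prime_mult_iff[OF m(1)] by blast
    qed
    have "?a p \<noteq> ?b p'" if "p \<in> ?P" for p p'
    proof (cases p; cases p')
      fix x y x' y' assume p: "p = (x, y)" "p' = (x', y')"
      with that have "coprime x (int m * y)" by (simp add: twisted_primitive_points_def)
      from irrational[OF this, of y'] p show ?thesis by (simp add: vec_eq_iff forall_2)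
    qed
    then show ?thesis by blast
  qed
  moreover have "inj_on ?a ?P" "inj_on ?b ?P"
    using m2 by (auto intro!: inj_onI simp: vec_eq_iff forall_2)
  ultimately show ?thesis
    using m2 by (simp add: card_Un_disjoint finite_twisted_primitive_points card_image)
qed

lemma hecke_orbit_density:
  assumes "prime m" "m < 4" "hecke_lambda q = sqrt m"
  shows "((\<lambda>R. real (card (hecke_orbit q \<inter> square R)) / (4 * R\<^sup>2)) \<longlongrightarrow>
           12 * sqrt m / ((real m + 1) * pi\<^sup>2)) at_top"
  using tendsto_divide[OF twisted_primitive_points_density[OF assms(1)] tendsto_const[of 2]]
  by (simp add: card_hecke_orbit_square[OF assms] mult.commute)

theorem theorem1:
  shows "((\<lambda>R::real. real (card (hecke_orbit 4 \<inter> square R)) / (4 * R\<^sup>2))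
            \<longlongrightarrow> 4 * sqrt 2 / pi\<^sup>2) at_top
       \<and> ((\<lambda>R::real. real (card (hecke_orbit 6 \<inter> square R)) / (4 * R\<^sup>2))
            \<longlongrightarrow> 3 * sqrt 3 / pi\<^sup>2) at_top"
proof
  have "hecke_lambda 4 = sqrt (real 2)" "hecke_lambda 6 = sqrt (real 3)"
    by (simp_all add: hecke_lambda_def cos_45 cos_30)
  from this[THEN hecke_orbit_density[rotated 2]]
  show "((\<lambda>R::real. real (card (hecke_orbit 4 \<inter> square R)) / (4 * R\<^sup>2))
            \<longlongrightarrow> 4 * sqrt 2 / pi\<^sup>2) at_top"
    and "((\<lambda>R::real. real (card (hecke_orbit 6 \<inter> square R)) / (4 * R\<^sup>2))
            \<longlongrightarrow> 3 * sqrt 3 / pi\<^sup>2) at_top"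
    by simp_all
qed

end
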